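(* Let $r_1<r_2<\cdots$ be an increasing sequence of positive integers, and let $\sigma$ be a stable background on $\mathbb{Z}^d$ in which every site of $\mathcal{B}_{r_1}\cup\mathcal{B}_{r_2}\cup\cdots$ has at most $2d-2$ particles. Then $\sigma$ is robust.
   Context: Abelian sandpile on $\mathbb{Z}^d$: a configuration is a function $\eta:\mathbb{Z}^d\to\mathbb{Z}$; a site $x$ is unstable if $\eta(x)\ge2d$, and toppling it sends one particle to each of its $2d$ lattice neighbours; a configuration is stable if it is $\le 2d-1$ everywhere. $\delta_o$ is a single particle at the origin. Given a stable background $\sigma$ and $n\ge1$, enumerate the sites of $\mathbb{Z}^d$ and topple, at each discrete time step, the smallest unstable site of $\sigma+n\delta_o$ (if any); $T_n$ is the set of sites that ever topple. $\sigma$ is robust if $T_n$ is finite for every $n\ge1$. $Q_r=\{x\in\mathbb{Z}^d:\max_i|x_i|\le r\}$ and $\mathcal{B}_r=\partial Q_r=\{y\notin Q_r : y\text{ has a lattice neighbour in } Q_r\}$. *)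

theory Defs
  imports "HOL-Analysis.Finite_Cartesian_Product"
begin

text \<open>Sites of \<open>\<int>\<^sup>d\<close> are vectors of type \<open>int ^ 'd\<close>, where \<open>d = CARD('d)\<close>.\<close>

definition lattice_adj :: "int ^ 'd \<Rightarrow> int ^ 'd \<Rightarrow> bool" where
  "lattice_adj x y \<longleftrightarrow> (\<exists>i. y = x + axis i 1 \<or> y = x - axis i 1)"

definition unstable :: "(int ^ 'd \<Rightarrow> int) \<Rightarrow> int ^ 'd \<Rightarrow> bool" where
  "unstable \<eta> x \<longleftrightarrow> \<eta> x \<ge> 2 * int CARD('d)"

definition stable_config :: "(int ^ 'd \<Rightarrow> int) \<Rightarrow> bool" where
  "stable_config \<eta> \<longleftrightarrow> (\<forall>x. \<eta> x \<le> 2 * int CARD('d) - 1)"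

definition topple :: "int ^ 'd \<Rightarrow> (int ^ 'd \<Rightarrow> int) \<Rightarrow> (int ^ 'd \<Rightarrow> int)" where
  "topple x \<eta> = (\<lambda>y. \<eta> y - (if y = x then 2 * int CARD('d) else 0) + (if lattice_adj x y then 1 else 0))"

definition delta_o :: "int ^ 'd \<Rightarrow> int" where
  "delta_o x = (if x = 0 then 1 else 0)"

text \<open>Below, \<open>e\<close> is an enumeration of the sites, that is, a bijection from \<open>nat\<close> onto \<open>int ^ 'd\<close>.
  The value of \<open>smallest_unstable\<close> is meaningful only if there is an unstable site.\<close>

definition smallest_unstable :: "(nat \<Rightarrow> int ^ 'd) \<Rightarrow> (int ^ 'd \<Rightarrow> int) \<Rightarrow> int ^ 'd" where
  "smallest_unstable e \<eta> = e (LEAST k. unstable \<eta> (e k))"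

definition sandpile_step :: "(nat \<Rightarrow> int ^ 'd) \<Rightarrow> (int ^ 'd \<Rightarrow> int) \<Rightarrow> (int ^ 'd \<Rightarrow> int)" where
  "sandpile_step e \<eta> = (if \<exists>x. unstable \<eta> x then topple (smallest_unstable e \<eta>) \<eta> else \<eta>)"

definition sandpile_at ::
  "(nat \<Rightarrow> int ^ 'd) \<Rightarrow> (int ^ 'd \<Rightarrow> int) \<Rightarrow> nat \<Rightarrow> nat \<Rightarrow> (int ^ 'd \<Rightarrow> int)" where
  "sandpile_at e \<sigma> n t = (sandpile_step e ^^ t) (\<lambda>x. \<sigma> x + int n * delta_o x)"

text \<open>The set \<open>T\<^sub>n\<close> of sites that topple at some time.\<close>

definition toppled_sites :: "(nat \<Rightarrow> int ^ 'd) \<Rightarrow> (int ^ 'd \<Rightarrow> int) \<Rightarrow> nat \<Rightarrow> (int ^ 'd) set" where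
  "toppled_sites e \<sigma> n =
     {x. \<exists>t. (\<exists>y. unstable (sandpile_at e \<sigma> n t) y) \<and>
             x = smallest_unstable e (sandpile_at e \<sigma> n t)}"

definition robust :: "(nat \<Rightarrow> int ^ 'd) \<Rightarrow> (int ^ 'd \<Rightarrow> int) \<Rightarrow> bool" where
  "robust e \<sigma> \<longleftrightarrow> (\<forall>n\<ge>1. finite (toppled_sites e \<sigma> n))"

definition cube :: "nat \<Rightarrow> (int ^ 'd) set" where
  "cube r = {x. Max (range (\<lambda>i. \<bar>x $ i\<bar>)) \<le> int r}"

definition outer_boundary :: "(int ^ 'd) set \<Rightarrow> (int ^ 'd) set" where
  "outer_boundary A = {y. y \<notin> A \<and> (\<exists>x\<in>A. lattice_adj y x)}"

end

theory Submission imports Defs begin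

text \<open>By the least action principle, no legal toppling sequence topples a site more often than a
  finitely supported nonnegative function \<open>u\<close> whose toppling stabilizes \<open>\<sigma> + n\<delta>\<^sub>o\<close>. Such a \<open>u\<close> is
  the sum over \<open>k < n\<close> of the truncated cones \<open>max 0 (r\<^sub>k + 1 - \<bar>x\<bar>\<^sub>\<infinity>)\<close>, that is, toppling
  each of the cubes of radius \<open>r\<^sub>k, r\<^sub>k - 1, \<dots>, 0\<close> once: the Laplacian of such a cone is \<open>-2d\<close> at
  the origin and positive only on \<open>\<B>\<^bsub>r\<^sub>k\<^esub>\<close>, where it equals 1, and these boundaries are disjoint.\<close>

section \<open>The discrete Laplacian as the effect of toppling\<close>

definition lattice_laplacian :: "(int ^ 'd \<Rightarrow> int) \<Rightarrow> int ^ 'd \<Rightarrow> int" where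
  "lattice_laplacian u x = (\<Sum>y | lattice_adj y x. u y) - 2 * int CARD('d) * u x"

lemma axis_eq_axis_int_iff:
  "axis i (a::int) = axis j b \<longleftrightarrow> (i = j \<and> a = b) \<or> (a = 0 \<and> b = 0)"
  by (auto simp: vec_eq_iff axis_def)

lemma lattice_neighbours:
  "{y. lattice_adj y x} = range (\<lambda>i. x + axis i 1) \<union> range (\<lambda>i. x - axis i 1)"
  by (auto simp: lattice_adj_def algebra_simps image_iff)

lemma finite_lattice_neighbours [simp]: "finite {y. lattice_adj y (x :: int ^ 'd)}"
  by (simp add: lattice_neighbours)

lemma lattice_adj_irrefl [simp]: "\<not> lattice_adj x x"
  by (auto simp: lattice_adj_def vec_eq_iff axis_def)

text \<open>The 2d neighbours are pairwise distinct, so the sum splits into second differences, one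
  per coordinate direction; the cone estimate treats each direction separately.\<close>

lemma lattice_laplacian_eq:
  fixes u :: "int ^ 'd \<Rightarrow> int"
  shows "lattice_laplacian u x = (\<Sum>i\<in>UNIV. u (x + axis i 1) + u (x - axis i 1) - 2 * u x)"
proof -
  have inj: "inj (\<lambda>i::'d. x + axis i 1)" "inj (\<lambda>i::'d. x - axis i 1)"
    by (auto simp: inj_def axis_eq_axis_int_iff)
  have "x + axis i 1 \<noteq> x - axis j 1" for i j
  proof
    assume "x + axis i 1 = x - axis j 1"
    then have "axis i (1::int) = axis j (- 1)"
      by (auto simp: vec_eq_iff axis_def split: if_splits)
    then show False by (simp add: axis_eq_axis_int_iff)
  qed
  then have disj: "range (\<lambda>i. x + axis i 1) \<inter> range (\<lambda>i. x - axis i 1) = {}"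
    by auto
  have "(\<Sum>y | lattice_adj y x. u y)
      = (\<Sum>i\<in>UNIV. u (x + axis i 1)) + (\<Sum>i\<in>UNIV. u (x - axis i 1))"
    unfolding lattice_neighbours
    by (simp add: sum.union_disjoint[OF _ _ disj] sum.reindex[OF inj(1)] sum.reindex[OF inj(2)])
  then show ?thesis
    by (simp add: lattice_laplacian_def sum.distrib sum_subtractf)
qed

lemma lattice_laplacian_sum:
  "lattice_laplacian (\<lambda>x. \<Sum>k\<in>A. u k x) x = (\<Sum>k\<in>A. lattice_laplacian (u k) x)"
  unfolding lattice_laplacian_def
  by (simp add: sum_subtractf sum_distrib_left sum.swap[of _ A])

text \<open>Lets a run of the process be tracked by its odometer \<open>v\<close>, the number of
  topplings at each site: the Laplacian of the indicator of \<open>x\<close> is the effect of one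
  toppling at \<open>x\<close>.\<close>

lemma topple_laplacian:
  fixes v :: "int ^ 'd \<Rightarrow> int"
  shows "topple x (\<lambda>y. \<eta> y + lattice_laplacian v y)
    = (\<lambda>y. \<eta> y + lattice_laplacian (v(x := v x + 1)) y)"
proof
  fix y
  have upd: "v(x := v x + 1) = (\<lambda>z. v z + (if z = x then 1 else 0))" by auto
  have "(\<Sum>z | lattice_adj z y. (if z = x then 1 else 0 :: int)) = (if lattice_adj x y then 1 else 0)"
    by (simp add: sum.delta)
  then show "topple x (\<lambda>y. \<eta> y + lattice_laplacian v y) y
      = \<eta> y + lattice_laplacian (v(x := v x + 1)) y"
    unfolding upd lattice_laplacian_def topple_def sum.distrib by (simp add: algebra_simps)
qed

section \<open>Least action and the set of toppled sites\<close>

lemma unstable_smallest_unstable: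
  assumes "surj e" "unstable \<eta> x"
  shows "unstable \<eta> (smallest_unstable e \<eta>)"
  using assms unfolding smallest_unstable_def by (metis LeastI surj_def)

text \<open>If \<open>v x = u x\<close>, then \<open>x\<close> has lost as much under
  \<open>v\<close> as under \<open>u\<close> and, as \<open>v\<close> is at most \<open>u\<close> at
  its neighbours, has received no more. So it holds no more than in the stable
  configuration.\<close>

lemma least_action:
  fixes \<eta> :: "int ^ 'd \<Rightarrow> int"
  assumes "\<forall>y. v y \<le> u y"
    and "stable_config (\<lambda>y. \<eta> y + lattice_laplacian u y)"
    and "unstable (\<lambda>y. \<eta> y + lattice_laplacian v y) x"
  shows "v x < u x"
proof (rule ccontr)
  assume "\<not> v x < u x"
  with assms(1) have "v x = u x" by (meson order_le_less)
  then have "lattice_laplacian v x \<le> lattice_laplacian u x"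
    using assms(1) by (simp add: lattice_laplacian_def sum_mono)
  moreover have "\<eta> x + lattice_laplacian u x \<le> 2 * int CARD('d) - 1"
    using assms(2) by (simp add: stable_config_def)
  ultimately show False using assms(3) by (simp add: unstable_def)
qed

text \<open>Induction on time keeps the odometer between 0 and \<open>u\<close>: a site about to
  topple is unstable, so \<open>least_action\<close> leaves room for one more toppling
  there.\<close>

lemma toppled_sites_subset:
  fixes \<sigma> :: "int ^ 'd \<Rightarrow> int"
  assumes "surj e" and "\<forall>x. 0 \<le> u x"
    and stab: "stable_config (\<lambda>x. \<sigma> x + int n * delta_o x + lattice_laplacian u x)"
  shows "toppled_sites e \<sigma> n \<subseteq> {x. 0 < u x}"
proof
  define \<eta> where "\<eta> = (\<lambda>x. \<sigma> x + int n * delta_o x)"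
  have stab: "stable_config (\<lambda>x. \<eta> x + lattice_laplacian u x)"
    using stab by (simp add: \<eta>_def)
  have odometer: "\<exists>v. (\<forall>x. 0 \<le> v x \<and> v x \<le> u x) \<and>
      sandpile_at e \<sigma> n t = (\<lambda>x. \<eta> x + lattice_laplacian v x)" for t
  proof (induction t)
    case 0
    show ?case
      using assms(2) by (intro exI[of _ "\<lambda>_. 0"]) (simp add: sandpile_at_def \<eta>_def lattice_laplacian_def)
  next
    case (Suc t)
    then obtain v where v: "\<forall>x. 0 \<le> v x \<and> v x \<le> u x"
      "sandpile_at e \<sigma> n t = (\<lambda>x. \<eta> x + lattice_laplacian v x)" by blast
    have step: "sandpile_at e \<sigma> n (Suc t) = sandpile_step e (sandpile_at e \<sigma> n t)"
      by (simp add: sandpile_at_def)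
    show ?case
    proof (cases "\<exists>x. unstable (sandpile_at e \<sigma> n t) x")
      case True
      define x where "x = smallest_unstable e (sandpile_at e \<sigma> n t)"
      have "v x < u x"
        using True unstable_smallest_unstable[OF assms(1)] v stab unfolding x_def
        by (intro least_action[of v u \<eta>]) auto
      moreover have "sandpile_at e \<sigma> n (Suc t) = (\<lambda>y. \<eta> y + lattice_laplacian (v(x := v x + 1)) y)"
        using True unfolding step sandpile_step_def
        by (simp flip: x_def) (simp add: v(2) topple_laplacian)
      moreover have "\<forall>y. 0 \<le> (v(x := v x + 1)) y \<and> (v(x := v x + 1)) y \<le> u y"
        using v(1) \<open>v x < u x\<close> by auto
      ultimately show ?thesis by blast
    next
      case False
      then show ?thesis using v step by (auto simp: sandpile_step_def)
    qed
  qed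
  fix x
  assume "x \<in> toppled_sites e \<sigma> n"
  then obtain t where "unstable (sandpile_at e \<sigma> n t) x"
    using unstable_smallest_unstable[OF assms(1)] unfolding toppled_sites_def by blast
  moreover obtain v where "\<forall>x. 0 \<le> v x \<and> v x \<le> u x"
      "sandpile_at e \<sigma> n t = (\<lambda>x. \<eta> x + lattice_laplacian v x)"
    using odometer by blast
  ultimately have "0 \<le> v x" "v x < u x"
    using least_action[OF _ stab, of v x] by auto
  then show "x \<in> {x. 0 < u x}" by simp
qed

section \<open>Sup norm, cubes and their boundaries\<close>

definition sup_abs :: "int ^ 'd \<Rightarrow> int" where
  "sup_abs x = Max (range (\<lambda>i. \<bar>x $ i\<bar>))"

lemma mem_cube_iff: "x \<in> cube r \<longleftrightarrow> sup_abs x \<le> int r"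
  by (simp add: cube_def sup_abs_def)

lemma sup_abs_le_iff: "sup_abs x \<le> m \<longleftrightarrow> (\<forall>i. \<bar>x $ i\<bar> \<le> m)"
  by (simp add: sup_abs_def)

lemma abs_le_sup_abs: "\<bar>x $ i\<bar> \<le> sup_abs x"
  using sup_abs_le_iff by blast

lemma sup_abs_attained:
  obtains i where "sup_abs x = \<bar>x $ i\<bar>"
proof -
  have "sup_abs x \<in> range (\<lambda>i. \<bar>x $ i\<bar>)"
    unfolding sup_abs_def by (rule Max_in) auto
  then show ?thesis using that by blast
qed

lemma sup_abs_0 [simp]: "sup_abs 0 = 0"
  by (simp add: sup_abs_def)

lemma finite_cube: "finite (cube r :: (int ^ 'd) set)"
proof -
  have "cube r \<subseteq> vec_lambda ` (PiE UNIV (\<lambda>_::'d. {- int r..int r}))"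
  proof
    fix x :: "int ^ 'd"
    assume "x \<in> cube r"
    then have "\<bar>x $ i\<bar> \<le> int r" for i by (simp add: mem_cube_iff sup_abs_le_iff)
    then have "vec_nth x \<in> PiE UNIV (\<lambda>_. {- int r..int r})"
      by (auto simp: abs_le_iff minus_le_iff)
    then show "x \<in> vec_lambda ` (PiE UNIV (\<lambda>_. {- int r..int r}))"
      by (metis image_eqI vec_nth_inverse)
  qed
  then show ?thesis by (rule finite_subset) (simp add: finite_PiE)
qed

lemma sup_abs_lattice_adj:
  assumes "lattice_adj y x"
  shows "sup_abs y \<le> sup_abs x + 1"
proof -
  have "\<bar>y $ i\<bar> \<le> \<bar>x $ i\<bar> + 1" for i
    using assms by (auto simp: lattice_adj_def axis_def)
  then show ?thesis
    unfolding sup_abs_le_iff using abs_le_sup_abs[of x] by (meson add_right_mono order_trans)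
qed

lemma lattice_adj_axis [simp]:
  "lattice_adj x (x + axis i 1)" "lattice_adj x (x - axis i 1)"
  by (auto simp: lattice_adj_def)

text \<open>The converse fails for d \<ge> 2: a site with two coordinates of modulus
  \<open>r + 1\<close> has no neighbour in the cube.\<close>

lemma sup_abs_outer_boundary:
  assumes "x \<in> outer_boundary (cube r)"
  shows "sup_abs x = int r + 1"
  using assms sup_abs_lattice_adj[of x] by (force simp: outer_boundary_def mem_cube_iff)

section \<open>Truncated cones\<close>

definition cone :: "nat \<Rightarrow> int ^ 'd \<Rightarrow> int" where
  "cone r x = max 0 (int r + 1 - sup_abs x)"

lemma lattice_laplacian_cone_0: "lattice_laplacian (cone r) (0 :: int ^ 'd) = - 2 * int CARD('d)"
proof -
  have "sup_abs (axis i 1 :: int ^ 'd) = 1" "sup_abs (- axis i 1 :: int ^ 'd) = 1" for i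
  proof -
    have *: "sup_abs (axis i 1 :: int ^ 'd) \<le> 1" "sup_abs (- axis i 1 :: int ^ 'd) \<le> 1"
      by (auto simp: sup_abs_le_iff axis_def)
    then show "sup_abs (axis i 1 :: int ^ 'd) = 1" "sup_abs (- axis i 1 :: int ^ 'd) = 1"
      using abs_le_sup_abs[of "axis i 1" i] abs_le_sup_abs[of "- axis i 1" i] by simp_all
  qed
  then show ?thesis by (simp add: lattice_laplacian_eq cone_def)
qed

text \<open>Fix a coordinate attaining the norm. Steps in other directions never lower the norm, so
  they contribute at most 0. Along this coordinate one step raises the norm and the other lowers it
  by at most 1, so only the truncation at 0 can make the second difference positive.\<close>

lemma lattice_laplacian_cone_le:
  assumes "x \<noteq> 0"
  shows "lattice_laplacian (cone r) x \<le> of_bool (x \<in> outer_boundary (cube r))"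
proof -
  obtain i where i: "sup_abs x = \<bar>x $ i\<bar>" by (rule sup_abs_attained)
  define D where "D j = cone r (x + axis j 1) + cone r (x - axis j 1) - 2 * cone r x" for j
  have "D j \<le> 0" if "j \<noteq> i" for j
  proof -
    have "axis j 1 $ i = (0 :: int)" using that by (simp add: axis_def)
    then have "sup_abs x \<le> sup_abs (x + axis j 1)" "sup_abs x \<le> sup_abs (x - axis j 1)"
      using abs_le_sup_abs[of "x + axis j 1" i] abs_le_sup_abs[of "x - axis j 1" i] i by simp_all
    then have "cone r (x + axis j 1) \<le> cone r x" "cone r (x - axis j 1) \<le> cone r x"
      by (auto simp: cone_def)
    then show ?thesis by (simp add: D_def)
  qed
  then have "sum D (UNIV - {i}) \<le> 0" by (intro sum_nonpos) simp
  then have "lattice_laplacian (cone r) x \<le> D i"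
    by (simp add: lattice_laplacian_eq sum.remove[of UNIV i] flip: D_def)
  also have "D i \<le> of_bool (x \<in> outer_boundary (cube r))"
  proof -
    have pos: "sup_abs x \<ge> 1"
    proof (rule ccontr)
      assume "\<not> sup_abs x \<ge> 1"
      then have "sup_abs x \<le> 0" by simp
      then show False using assms by (simp add: sup_abs_le_iff vec_eq_iff)
    qed
    have le: "\<bar>x $ i + 1\<bar> \<le> sup_abs (x + axis i 1)" "\<bar>x $ i - 1\<bar> \<le> sup_abs (x - axis i 1)"
      using abs_le_sup_abs[of "x + axis i 1" i] abs_le_sup_abs[of "x - axis i 1" i] by simp_all
    show ?thesis
    proof (cases "x \<in> outer_boundary (cube r)")
      case True
      then have "sup_abs x = int r + 1" by (rule sup_abs_outer_boundary)
      \<comment> \<open>The cone vanishes at \<open>x\<close> and at the outward neighbour, and is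
        at most 1 at the inward one.\<close>
      with le i True show ?thesis by (simp add: D_def cone_def)
    next
      case False
      \<comment> \<open>In the cube, truncation has no effect up to norm \<open>r + 1\<close>, so
        the two changes cannot add up to more than 0; in the other case both neighbours have value
        0.\<close>
      then have "x \<in> cube r \<or> (x + axis i 1 \<notin> cube r \<and> x - axis i 1 \<notin> cube r)"
        using lattice_adj_axis by (auto simp: outer_boundary_def)
      with le i pos False show ?thesis
        by (auto simp: D_def cone_def mem_cube_iff)
    qed
  qed
  finally show ?thesis .
qed

theorem theorem4p2:
  fixes r :: "nat \<Rightarrow> nat"
    and \<sigma> :: "int ^ 'd \<Rightarrow> int"
    and e :: "nat \<Rightarrow> int ^ 'd"
  assumes "bij e"
    and "strict_mono r"
    and "\<forall>k. r k > 0"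
    and "stable_config \<sigma>"
    and "\<forall>x \<in> (\<Union>k. outer_boundary (cube (r k))). \<sigma> x \<le> 2 * int CARD('d) - 2"
  shows "robust e \<sigma>"
  unfolding robust_def
proof (intro allI impI)
  fix n :: nat
  \<comment> \<open>One cone per added particle suffices: each removes 2d \<ge> 1 particles from the
    origin.\<close>
  define u :: "int ^ 'd \<Rightarrow> int" where "u = (\<lambda>x. \<Sum>k<n. cone (r k) x)"
  have "\<sigma> x + int n * delta_o x + lattice_laplacian u x \<le> 2 * int CARD('d) - 1" for x
  proof (cases "x = 0")
    case True
    have "int n * 1 \<le> int n * (2 * int CARD('d))"
      using zero_less_card_finite[where 'a = 'd] by (intro mult_left_mono) linarith+
    moreover have "\<sigma> 0 \<le> 2 * int CARD('d) - 1"
      using assms(4) by (simp add: stable_config_def)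
    ultimately show ?thesis
      by (simp add: True u_def lattice_laplacian_sum lattice_laplacian_cone_0 delta_o_def)
  next
    case False
    define K where "K = {k. k < n \<and> x \<in> outer_boundary (cube (r k))}"
    have "lattice_laplacian u x \<le> (\<Sum>k<n. of_bool (x \<in> outer_boundary (cube (r k))))"
      unfolding u_def lattice_laplacian_sum
      by (intro sum_mono lattice_laplacian_cone_le False)
    also have "\<dots> = int (card K)"
      by (simp add: of_bool_def sum.If_cases K_def Int_def)
    finally have le: "lattice_laplacian u x \<le> int (card K)" .
    \<comment> \<open>The norm of \<open>x\<close> is \<open>r k + 1\<close>, which determines
      \<open>k\<close> since \<open>r\<close> is injective.\<close>
    have "k = l" if "k \<in> K" "l \<in> K" for k l
    proof -
      have "r k = r l" using that by (auto simp: K_def dest!: sup_abs_outer_boundary)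
      then show ?thesis using assms(2) by (simp add: strict_mono_eq)
    qed
    then have "card K \<le> 1" by (simp add: card_le_Suc0_iff_eq K_def)
    moreover have "\<sigma> x \<le> 2 * int CARD('d) - 1"
      using assms(4) by (simp add: stable_config_def)
    \<comment> \<open>If \<open>K\<close> is empty, nothing is gained at \<open>x\<close> and
      stability suffices; otherwise the single particle gained fits under the stricter
      bound.\<close>
    moreover have "\<sigma> x \<le> 2 * int CARD('d) - 2" if "K \<noteq> {}"
      using that assms(5) by (auto simp: K_def)
    ultimately show ?thesis
      using le False by (cases "K = {}") (auto simp: delta_o_def)
  qed
  then have "toppled_sites e \<sigma> n \<subseteq> {x. 0 < u x}"
    using assms(1)
    by (intro toppled_sites_subset) (auto simp: stable_config_def bij_def u_def cone_def sum_nonneg)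
  also have "\<dots> \<subseteq> (\<Union>k<n. cube (r k))"
  proof
    fix x
    assume "x \<in> {x. 0 < u x}"
    then obtain k where "k < n" "0 < cone (r k) x"
      unfolding u_def by (metis (mono_tags) lessThan_iff mem_Collect_eq not_le sum_nonpos)
    \<comment> \<open>The offset 1 in \<open>cone\<close> makes its support exactly the cube: over
      the integers, norm below \<open>r k + 1\<close> means norm at most \<open>r k\<close>.\<close>
    then show "x \<in> (\<Union>k<n. cube (r k))" by (force simp: cone_def mem_cube_iff max_def split: if_splits)
  qed
  finally show "finite (toppled_sites e \<sigma> n)"
    by (rule finite_subset) (simp add: finite_cube)
qed

end
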